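(* Let $(X,X_+,\mathcal K,f)$ be an abstract state space and let $P\ne I$ be a Markov projection on $X$. Then the set $\Sigma_P^{w}(X)$ is a norm dense and (norm) open subset of $\Sigma_P(X)$.
   Context: Let $X$ be a real ordered vector space with generating cone $X_+$ ($X=X_+-X_+$), let $f$ be a strictly positive linear functional on $X$ ($f(x)>0$ for $x>0$), and let $\mathcal K=\{x\in X_+: f(x)=1\}$. Let $U$ be the convex hull of $\mathcal K\cup(-\mathcal K)$ and $\|x\|=\inf\{t\ge 0: x\in tU\}$. $(X,X_+,\mathcal K,f)$ is an abstract state space if this seminorm is a norm, $X$ is complete for it, and $X_+$ is closed; $X$ always carries this norm. A linear operator $T:X\to X$ is Markov if it is positive and $T(\mathcal K)\subset\mathcal K$; a Markov projection is a Markov operator $P$ with $P^2=P$. $\Sigma_P(X)$ is the set of Markov operators $T$ on $X$ with $TP=PT$. For a projection $P\ne I$ and a bounded linear operator $T$, $\delta_P(T)=\sup\{\|Tx\|/\|x\| : Px=0,\ x\ne0\}$. $T$ is weakly $P$-ergodic if $\delta_P(T^n)\to0$ as $n\to\infty$, and $\Sigma_P^w(X)=\{T\in\Sigma_P(X): T\text{ is weakly }P\text{-ergodic}\}$. Dense and open refer to the operator norm topology. *)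

theory Defs
  imports "HOL-Analysis.Analysis"
begin

definition state_base :: "('a::ordered_real_vector \<Rightarrow> real) \<Rightarrow> 'a set" where
  "state_base f = {x. 0 \<le> x \<and> f x = 1}"

definition base_ball :: "('a::ordered_real_vector \<Rightarrow> real) \<Rightarrow> 'a set" where
  "base_ball f = convex hull (state_base f \<union> uminus ` state_base f)"

definition base_norm :: "('a::ordered_real_vector \<Rightarrow> real) \<Rightarrow> 'a \<Rightarrow> real" where
  "base_norm f x = Inf {t. 0 \<le> t \<and> x \<in> (*\<^sub>R) t ` base_ball f}"

text \<open>
  The cone is the set of elements \<open>0 \<le> x\<close> of the ordered vector space, and the norm, the topology
  and the operator norm are those of the type class \<open>banach\<close>.  The assumption \<open>norm_eq\<close> identifies
  the class norm with the gauge of the base ball; together with the class axioms it says that the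
  gauge is a norm and that the space is complete for it.
\<close>

locale abstract_state_space =
  fixes f :: "'a::{banach, ordered_real_vector} \<Rightarrow> real"
  assumes linear_f: "linear f"
    and strictly_positive: "\<And>x::'a. 0 < x \<Longrightarrow> 0 < f x"
    and generating: "\<And>x::'a. \<exists>y z. 0 \<le> y \<and> 0 \<le> z \<and> x = y - z"
    and norm_eq: "\<And>x. norm x = base_norm f x"
    and closed_cone: "closed {x::'a. 0 \<le> x}"

definition markov :: "('a::ordered_real_vector \<Rightarrow> real) \<Rightarrow> ('a \<Rightarrow> 'a) \<Rightarrow> bool" where
  "markov f T \<longleftrightarrow> linear T \<and> (\<forall>x\<ge>0. 0 \<le> T x) \<and> T ` state_base f \<subseteq> state_base f"

definition markov_projection :: "('a::ordered_real_vector \<Rightarrow> real) \<Rightarrow> ('a \<Rightarrow> 'a) \<Rightarrow> bool" where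
  "markov_projection f P \<longleftrightarrow> markov f P \<and> P \<circ> P = P"

text \<open>
  On an abstract state space every Markov operator is bounded (\<open>markov_bounded_linear\<close> below), so
  taking the elements of \<open>commuting_markov\<close> from the space of bounded operators, which supplies
  the operator norm, excludes none.
\<close>

definition commuting_markov ::
    "('a::{real_normed_vector, ordered_real_vector} \<Rightarrow> real) \<Rightarrow> ('a \<Rightarrow> 'a) \<Rightarrow> ('a \<Rightarrow>\<^sub>L 'a) set" where
  "commuting_markov f P =
     {T. markov f (blinfun_apply T) \<and> blinfun_apply T \<circ> P = P \<circ> blinfun_apply T}"

text \<open>
  The supremum is over a nonempty set bounded above whenever \<open>P\<close> is a projection other than the
  identity and \<open>T\<close> is bounded.
\<close>

definition ergodicity_coeff :: "('a::real_normed_vector \<Rightarrow> 'a) \<Rightarrow> ('a \<Rightarrow> 'a) \<Rightarrow> real" where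
  "ergodicity_coeff P T = Sup {norm (T x) / norm x | x. P x = 0 \<and> x \<noteq> 0}"

definition weakly_ergodic :: "('a::real_normed_vector \<Rightarrow> 'a) \<Rightarrow> ('a \<Rightarrow> 'a) \<Rightarrow> bool" where
  "weakly_ergodic P T \<longleftrightarrow> (\<lambda>n. ergodicity_coeff P (T ^^ n)) \<longlonglongrightarrow> 0"

definition weakly_ergodic_markov ::
    "('a::{real_normed_vector, ordered_real_vector} \<Rightarrow> real) \<Rightarrow> ('a \<Rightarrow> 'a) \<Rightarrow> ('a \<Rightarrow>\<^sub>L 'a) set" where
  "weakly_ergodic_markov f P = {T \<in> commuting_markov f P. weakly_ergodic P (blinfun_apply T)}"

lemma (in abstract_state_space) base_ball_absorbing:
  assumes "x \<noteq> 0"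
  shows "\<exists>t\<ge>0. x \<in> (*\<^sub>R) t ` base_ball f"
proof -
  obtain y z where yz: "0 \<le> y" "0 \<le> z" "x = y - z"
    using generating[of x] by blast
  have f0: "f 0 = 0" using linear_f by (rule linear_0)
  have pos: "0 \<le> f v" if "0 \<le> v" for v
    using that strictly_positive[of v] f0 le_less[of 0 v] less_imp_le[of 0 "f v"] by auto
  have nrm: "(1 / f v) *\<^sub>R v \<in> state_base f" if "0 < v" for v
    using strictly_positive[OF that] less_imp_le[OF that] linear_cmul[OF linear_f, of "1 / f v" v]
    by (simp add: state_base_def scaleR_nonneg_nonneg)
  have ball: "k \<in> base_ball f" "- k \<in> base_ball f" if "k \<in> state_base f" for k
    using that by (auto simp: base_ball_def intro!: hull_inc)
  have conv: "convex (base_ball f)"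
    by (simp add: base_ball_def)
  consider "y = 0" | "z = 0" | "0 < y" "0 < z"
    using yz(1,2) le_less[of 0 y] le_less[of 0 z] by metis
  then show ?thesis
  proof cases
    case 1
    then have z: "0 < z" using yz assms le_less[of 0 z] by auto
    have "x = f z *\<^sub>R (- ((1 / f z) *\<^sub>R z))"
      using 1 yz strictly_positive[OF z] by simp
    then show ?thesis
      using ball(2)[OF nrm[OF z]] pos[OF yz(2)] by blast
  next
    case 2
    then have y: "0 < y" using yz assms le_less[of 0 y] by auto
    have "x = f y *\<^sub>R ((1 / f y) *\<^sub>R y)"
      using 2 yz strictly_positive[OF y] by simp
    then show ?thesis
      using ball(1)[OF nrm[OF y]] pos[OF yz(1)] by blast
  next
    case 3
    define a b where "a = f y" and "b = f z"
    have ab: "0 < a" "0 < b" using 3 strictly_positive by (auto simp: a_def b_def)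
    let ?u = "(a / (a + b)) *\<^sub>R ((1 / a) *\<^sub>R y) + (b / (a + b)) *\<^sub>R (- ((1 / b) *\<^sub>R z))"
    have "?u \<in> base_ball f"
      using ab ball(1)[OF nrm[OF 3(1)]] ball(2)[OF nrm[OF 3(2)]]
      by (intro convexD[OF conv]) (auto simp: a_def b_def add_divide_distrib[symmetric])
    moreover have "x = (a + b) *\<^sub>R ?u"
      using ab yz by (simp add: scaleR_diff_right)
    ultimately show ?thesis
      using ab by (intro exI[of _ "a + b"]) auto
  qed
qed

lemma (in abstract_state_space) markov_norm_le:
  assumes "markov f T"
  shows "norm (T x) \<le> norm x"
proof (cases "x = 0")
  case True
  then show ?thesis
    using assms by (simp add: markov_def linear_0)
next
  case False
  have lin: "linear T" and K: "T ` state_base f \<subseteq> state_base f"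
    using assms by (auto simp: markov_def)
  have "T ` base_ball f = convex hull (T ` (state_base f \<union> uminus ` state_base f))"
    by (simp add: base_ball_def convex_hull_linear_image[OF lin])
  also have "\<dots> \<subseteq> base_ball f"
    unfolding base_ball_def using K linear_neg[OF lin] by (intro hull_mono) auto
  finally have U: "T ` base_ball f \<subseteq> base_ball f" .
  have "T x \<in> (*\<^sub>R) t ` base_ball f" if "x \<in> (*\<^sub>R) t ` base_ball f" for t
    using that U linear_cmul[OF lin] by auto
  then have "{t. 0 \<le> t \<and> x \<in> (*\<^sub>R) t ` base_ball f} \<subseteq> {t. 0 \<le> t \<and> T x \<in> (*\<^sub>R) t ` base_ball f}"
    by auto
  moreover have "{t. 0 \<le> t \<and> x \<in> (*\<^sub>R) t ` base_ball f} \<noteq> {}"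
    using base_ball_absorbing[OF False] by auto
  moreover have "bdd_below {t. 0 \<le> t \<and> T x \<in> (*\<^sub>R) t ` base_ball f}"
    by (rule bdd_belowI[of _ 0]) auto
  ultimately show ?thesis
    unfolding norm_eq base_norm_def by (intro cInf_superset_mono)
qed

lemma (in abstract_state_space) markov_bounded_linear:
  assumes "markov f T"
  shows "bounded_linear T"
  using assms markov_norm_le[OF assms]
  by (intro bounded_linear_intro[of T 1]) (auto simp: markov_def linear_add linear_cmul)

end

theory Submission
  imports Defs
begin

text \<open>
  Markov operators are contractions for the base norm, and an operator that commutes with \<open>P\<close>
  leaves the kernel of \<open>P\<close> invariant.  For such an operator \<open>T\<close> the coefficients of the powers
  are submultiplicative and nonincreasing, so weak ergodicity is equivalent to a condition on a
  single power (\<open>weakly_ergodic_iff_power_contracts\<close>): some \<open>T ^^ n\<close> with \<open>n > 0\<close> contracts the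
  kernel of \<open>P\<close> by a factor less than \<open>1\<close>.

  This is an open condition, because \<open>T ^^ n\<close> depends continuously on \<open>T\<close>; for
  contractions, \<open>S ^^ n\<close> and \<open>T ^^ n\<close> differ by at most \<open>n\<close> times the distance of \<open>S\<close> and \<open>T\<close>.
  It is dense, because for \<open>0 < e \<le> 1\<close> the operator \<open>(1 - e) T + e P\<close> is Markov, commutes with
  \<open>P\<close>, tends to \<open>T\<close> as \<open>e\<close> tends to \<open>0\<close>, and on the kernel of \<open>P\<close> equals \<open>(1 - e) T\<close>, which contracts with \<open>n = 1\<close>.
\<close>

lemma norm_funpow_le:
  fixes T :: "'a::real_normed_vector \<Rightarrow> 'a"
  assumes "\<And>x. norm (T x) \<le> norm x"
  shows "norm ((T ^^ n) x) \<le> norm x"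
  by (induction n) (auto intro: order_trans[OF assms])

lemma funpow_kernel_invariant:
  assumes "\<And>x. P x = 0 \<Longrightarrow> P (T x) = 0" and "P x = 0"
  shows "P ((T ^^ n) x) = 0"
  using assms by (induction n) auto

lemma ergodicity_coeff_le:
  fixes P T :: "'a::real_normed_vector \<Rightarrow> 'a"
  assumes "P z = 0" "z \<noteq> 0" and "\<And>x. P x = 0 \<Longrightarrow> norm (T x) \<le> b * norm x"
  shows "ergodicity_coeff P T \<le> b"
  unfolding ergodicity_coeff_def
  using assms by (intro cSup_least) (auto simp: divide_le_eq)

lemma norm_le_ergodicity_coeff:
  fixes P T :: "'a::real_normed_vector \<Rightarrow> 'a"
  assumes "P x = 0" and "\<And>x. norm (T x) \<le> b * norm x"
  shows "norm (T x) \<le> ergodicity_coeff P T * norm x"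
proof (cases "x = 0")
  case True
  then show ?thesis using assms(2)[of 0] by simp
next
  case False
  have "norm (T x) / norm x \<le> ergodicity_coeff P T"
    unfolding ergodicity_coeff_def
  proof (rule cSup_upper)
    show "norm (T x) / norm x \<in> {norm (T x) / norm x |x. P x = 0 \<and> x \<noteq> 0}"
      using False assms(1) by blast
    show "bdd_above {norm (T x) / norm x |x. P x = 0 \<and> x \<noteq> 0}"
      using assms(2) by (intro bdd_aboveI[of _ b]) (auto simp: divide_le_eq)
  qed
  then show ?thesis using False by (simp add: divide_le_eq)
qed

lemma norm_funpow_mult_le:
  fixes P T :: "'a::real_normed_vector \<Rightarrow> 'a"
  assumes inv: "\<And>x. P x = 0 \<Longrightarrow> P (T x) = 0"
    and c: "0 \<le> c" "\<And>x. P x = 0 \<Longrightarrow> norm ((T ^^ n) x) \<le> c * norm x"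
    and x: "P x = 0"
  shows "norm ((T ^^ (n * k)) x) \<le> c ^ k * norm x"
proof (induction k)
  case (Suc k)
  have "norm ((T ^^ (n * Suc k)) x) = norm ((T ^^ n) ((T ^^ (n * k)) x))"
    by (simp add: funpow_add)
  also have "\<dots> \<le> c * norm ((T ^^ (n * k)) x)"
    using funpow_kernel_invariant[of P T, OF inv x] by (intro c(2))
  also have "\<dots> \<le> c * (c ^ k * norm x)"
    using Suc.IH c(1) by (rule mult_left_mono)
  finally show ?case by (simp add: mult.assoc)
qed simp

text \<open>
  The powers between two multiples of \<open>n\<close> are controlled by the smaller multiple because \<open>T\<close>
  does not increase norms; hence the \<open>m\<close>-th coefficient is at most \<open>c ^ (m div n)\<close>.  The vector
  \<open>z\<close> says that the kernel is nontrivial, so that the coefficients are suprema over nonempty sets.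
\<close>

lemma weakly_ergodic_iff_power_contracts:
  fixes P T :: "'a::real_normed_vector \<Rightarrow> 'a"
  assumes z: "P z = 0" "z \<noteq> 0"
    and contr: "\<And>x. norm (T x) \<le> norm x"
    and inv: "\<And>x. P x = 0 \<Longrightarrow> P (T x) = 0"
  shows "weakly_ergodic P T \<longleftrightarrow>
           (\<exists>n>0. \<exists>c<1. \<forall>x. P x = 0 \<longrightarrow> norm ((T ^^ n) x) \<le> c * norm x)"
proof
  let ?d = "\<lambda>n. ergodicity_coeff P (T ^^ n)"
  have le: "norm ((T ^^ n) x) \<le> ?d n * norm x" if "P x = 0" for n x
    using that norm_funpow_le[of T, OF contr] by (intro norm_le_ergodicity_coeff[of _ _ _ 1]) auto
  {
    assume "weakly_ergodic P T"
    then have "?d \<longlonglongrightarrow> 0" by (simp add: weakly_ergodic_def)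
    then have "\<forall>\<^sub>F n in sequentially. ?d n < 1"
      by (rule order_tendstoD) simp
    then have "\<forall>\<^sub>F n in sequentially. 0 < n \<and> ?d n < 1"
      using eventually_gt_at_top[of 0] by eventually_elim simp
    then obtain n where "0 < n" "?d n < 1"
      unfolding eventually_sequentially by blast
    then show "\<exists>n>0. \<exists>c<1. \<forall>x. P x = 0 \<longrightarrow> norm ((T ^^ n) x) \<le> c * norm x"
      using le by blast
  next
    assume "\<exists>n>0. \<exists>c<1. \<forall>x. P x = 0 \<longrightarrow> norm ((T ^^ n) x) \<le> c * norm x"
    then obtain n c where n: "0 < n" and c: "c < 1"
      and nc: "\<And>x. P x = 0 \<Longrightarrow> norm ((T ^^ n) x) \<le> c * norm x"
      by blast
    have "0 \<le> c * norm z" using nc[OF z(1)] norm_ge_zero order_trans by blast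
    then have c0: "0 \<le> c" using z(2) by (simp add: zero_le_mult_iff)
    have lower: "0 \<le> ?d m" for m
    proof -
      have "0 \<le> ?d m * norm z" using le[OF z(1)] norm_ge_zero order_trans by blast
      then show ?thesis using z(2) by (simp add: zero_le_mult_iff)
    qed
    have upper: "?d m \<le> c ^ (m div n)" for m
    proof (rule ergodicity_coeff_le[where P = P, OF z])
      fix x assume x: "P x = 0"
      have "(T ^^ m) x = (T ^^ (m mod n + n * (m div n))) x" by simp
      also have "\<dots> = (T ^^ (m mod n)) ((T ^^ (n * (m div n))) x)"
        by (simp only: funpow_add comp_apply)
      finally have "norm ((T ^^ m) x) \<le> norm ((T ^^ (n * (m div n))) x)"
        using norm_funpow_le[of T, OF contr] by simp
      also have "\<dots> \<le> c ^ (m div n) * norm x"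
        using inv c0 nc x by (rule norm_funpow_mult_le)
      finally show "norm ((T ^^ m) x) \<le> c ^ (m div n) * norm x" .
    qed
    have lim: "(\<lambda>m. c ^ (m div n)) \<longlonglongrightarrow> 0"
      by (rule filterlim_compose[OF LIMSEQ_realpow_zero[OF c0 c] filterlim_at_top_div_const_nat[OF n]])
    show "weakly_ergodic P T"
      unfolding weakly_ergodic_def
      by (rule tendsto_sandwich[OF _ _ tendsto_const lim]) (simp_all add: lower upper)
  }
qed

text \<open>
  The increment of the bound from \<open>n\<close> to \<open>n + 1\<close> comes from splitting \<open>T (T ^^ n) - S (S ^^ n)\<close>
  as \<open>T (T ^^ n - S ^^ n) + (T - S) (S ^^ n)\<close>, where \<open>T\<close> and \<open>S ^^ n\<close> do not increase norms.
\<close>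

lemma norm_funpow_diff_le:
  fixes S T :: "'a::real_normed_vector \<Rightarrow>\<^sub>L 'a"
  assumes S: "\<And>x. norm (S x) \<le> norm x" and T: "\<And>x. norm (T x) \<le> norm x"
  shows "norm ((blinfun_apply T ^^ n) x - (blinfun_apply S ^^ n) x) \<le> real n * norm (T - S) * norm x"
proof (induction n)
  case (Suc n)
  let ?t = "(blinfun_apply T ^^ n) x" and ?s = "(blinfun_apply S ^^ n) x"
  have "(blinfun_apply T ^^ Suc n) x - (blinfun_apply S ^^ Suc n) x =
      T (?t - ?s) + (T - S) ?s"
    by (simp add: blinfun.diff_left blinfun.diff_right)
  also have "norm \<dots> \<le> norm (T (?t - ?s)) + norm ((T - S) ?s)"
    by (rule norm_triangle_ineq)
  also have "\<dots> \<le> real n * norm (T - S) * norm x + norm (T - S) * norm x"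
  proof (rule add_mono)
    show "norm (T (?t - ?s)) \<le> real n * norm (T - S) * norm x"
      using T Suc.IH by (rule order_trans)
    have "norm ((T - S) ?s) \<le> norm (T - S) * norm ?s"
      by (rule norm_blinfun)
    also have "\<dots> \<le> norm (T - S) * norm x"
      by (intro mult_left_mono norm_funpow_le[of S] S) simp
    finally show "norm ((T - S) ?s) \<le> norm (T - S) * norm x" .
  qed
  finally show ?case by (simp add: algebra_simps)
qed simp

lemma markov_convex_combination:
  fixes f :: "'a::ordered_real_vector \<Rightarrow> real"
  assumes "linear f" "markov f S" "markov f T" "0 \<le> e" "e \<le> 1"
  shows "markov f (\<lambda>x. (1 - e) *\<^sub>R S x + e *\<^sub>R T x)"
proof -
  have lin: "linear S" "linear T" using assms by (auto simp: markov_def)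
  have "f ((1 - e) *\<^sub>R S x + e *\<^sub>R T x) = 1" if "f (S x) = 1" "f (T x) = 1" for x
    using that by (simp add: linear_add[OF assms(1)] linear_cmul[OF assms(1)])
  moreover have "linear (\<lambda>x. (1 - e) *\<^sub>R S x + e *\<^sub>R T x)"
    by (intro linear_compose_add linear_compose_scale_right lin)
  ultimately show ?thesis
    using assms by (auto simp: markov_def state_base_def image_subset_iff
        intro!: add_nonneg_nonneg scaleR_nonneg_nonneg)
qed

lemma kernel_nontrivial_if_projection:
  fixes P :: "'a::real_vector \<Rightarrow> 'a"
  assumes "linear P" "P \<circ> P = P" "P \<noteq> id"
  obtains z where "P z = 0" "z \<noteq> 0"
proof -
  obtain x where "P x \<noteq> x" using assms(3) by (auto simp: fun_eq_iff)
  moreover have "P (x - P x) = 0"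
    using linear_diff[OF assms(1)] assms(2) by (simp add: fun_eq_iff)
  ultimately show thesis by (intro that[of "x - P x"]) auto
qed

context abstract_state_space
begin

lemma weakly_ergodic_markov_iff:
  assumes "markov_projection f P" "P \<noteq> id"
  shows "T \<in> weakly_ergodic_markov f P \<longleftrightarrow> T \<in> commuting_markov f P \<and>
           (\<exists>n>0. \<exists>c<1. \<forall>x. P x = 0 \<longrightarrow> norm ((blinfun_apply T ^^ n) x) \<le> c * norm x)"
proof (cases "T \<in> commuting_markov f P")
  case True
  have P: "linear P" "P \<circ> P = P"
    using assms(1) by (auto simp: markov_projection_def markov_def)
  obtain z where z: "P z = 0" "z \<noteq> 0"
    using kernel_nontrivial_if_projection[OF P assms(2)] .
  have "P (T x) = 0" if "P x = 0" for x
  proof -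
    have "P (T x) = T (P x)"
      using True by (simp add: commuting_markov_def fun_eq_iff)
    then show ?thesis using that by simp
  qed
  moreover have "norm (T x) \<le> norm x" for x
    using True by (intro markov_norm_le) (simp add: commuting_markov_def)
  ultimately show ?thesis
    using True weakly_ergodic_iff_power_contracts[where P = P and T = T, OF z]
    by (simp add: weakly_ergodic_markov_def)
qed (simp add: weakly_ergodic_markov_def)

text \<open>
  If \<open>T ^^ n\<close> contracts the kernel of \<open>P\<close> by the factor \<open>c\<close>, then \<open>S ^^ n\<close> contracts it by
  \<open>c + n * norm (S - T)\<close>, so the radius \<open>(1 - c) / n\<close> keeps the factor below \<open>1\<close>.
\<close>

lemma openin_weakly_ergodic_markov:
  assumes "markov_projection f P" "P \<noteq> id"
  shows "openin (top_of_set (commuting_markov f P)) (weakly_ergodic_markov f P)"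
  unfolding openin_euclidean_subtopology_iff
proof (intro conjI ballI)
  show "weakly_ergodic_markov f P \<subseteq> commuting_markov f P"
    by (auto simp: weakly_ergodic_markov_def)
  note iff = weakly_ergodic_markov_iff[OF assms]
  fix T assume "T \<in> weakly_ergodic_markov f P"
  then obtain n c where T: "T \<in> commuting_markov f P" and n: "0 < n" and c: "c < 1"
    and nc: "\<And>x. P x = 0 \<Longrightarrow> norm ((blinfun_apply T ^^ n) x) \<le> c * norm x"
    unfolding iff by blast
  have contr: "norm (S x) \<le> norm x" if "S \<in> commuting_markov f P" for S x
    using that by (intro markov_norm_le) (simp add: commuting_markov_def)
  show "\<exists>e>0. \<forall>S\<in>commuting_markov f P. dist S T < e \<longrightarrow> S \<in> weakly_ergodic_markov f P"
  proof (intro exI conjI ballI impI)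
    show "0 < (1 - c) / n" using n c by simp
    fix S assume S: "S \<in> commuting_markov f P" and "dist S T < (1 - c) / n"
    then have close: "c + real n * norm (S - T) < 1"
      using n by (simp add: dist_norm field_simps)
    have "norm ((blinfun_apply S ^^ n) x) \<le> (c + real n * norm (S - T)) * norm x" if "P x = 0" for x
    proof -
      have "norm ((blinfun_apply S ^^ n) x) \<le>
          norm ((blinfun_apply T ^^ n) x) + norm ((blinfun_apply S ^^ n) x - (blinfun_apply T ^^ n) x)"
        by (rule norm_triangle_sub)
      also have "\<dots> \<le> c * norm x + real n * norm (S - T) * norm x"
        using nc[OF that] norm_funpow_diff_le[OF contr[OF T] contr[OF S]] by (rule add_mono)
      finally show ?thesis by (simp add: algebra_simps)
    qed
    then show "S \<in> weakly_ergodic_markov f P"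
      unfolding iff using S n close by blast
  qed
qed

text \<open>
  The projection itself commutes with \<open>P\<close> and vanishes on the kernel, so mixing a little of it
  into \<open>T\<close> scales \<open>T\<close> on the kernel by a factor below \<open>1\<close>.
\<close>

lemma commuting_markov_subset_closure:
  assumes "markov_projection f P" "P \<noteq> id"
  shows "commuting_markov f P \<subseteq> closure (weakly_ergodic_markov f P)"
proof
  fix T assume "T \<in> commuting_markov f P"
  then have T: "markov f T" and TP: "T (P x) = P (T x)" for x
    by (auto simp: commuting_markov_def fun_eq_iff)
  have P: "markov f P" and PP: "P (P x) = P x" for x
    using assms(1) by (auto simp: markov_projection_def fun_eq_iff)
  have linP: "linear P" using P by (simp add: markov_def)
  define Q where "Q = Blinfun P"
  have Q: "blinfun_apply Q = P"
    unfolding Q_def using markov_bounded_linear[OF P] by (rule bounded_linear_Blinfun_apply)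
  define R where "R e = (1 - e) *\<^sub>R T + e *\<^sub>R Q" for e
  have R: "blinfun_apply (R e) = (\<lambda>x. (1 - e) *\<^sub>R T x + e *\<^sub>R P x)" for e
    by (simp add: R_def fun_eq_iff blinfun.add_left blinfun.scaleR_left Q)
  have mem: "R e \<in> weakly_ergodic_markov f P" if e: "0 < e" "e \<le> 1" for e
  proof -
    have "R e \<in> commuting_markov f P"
      using markov_convex_combination[OF linear_f T P] e
      by (auto simp: commuting_markov_def R fun_eq_iff TP PP linear_add[OF linP] linear_cmul[OF linP])
    moreover have "norm ((blinfun_apply (R e) ^^ 1) x) \<le> (1 - e) * norm x" if "P x = 0" for x
      using that e markov_norm_le[OF T, of x] by (simp add: R mult_left_mono)
    ultimately show ?thesis
      unfolding weakly_ergodic_markov_iff[OF assms] using e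
      by (auto intro!: exI[of _ 1] exI[of _ "1 - e"])
  qed
  show "T \<in> closure (weakly_ergodic_markov f P)"
    unfolding closure_sequential
  proof (intro exI conjI allI)
    show "R (inverse (real (Suc k))) \<in> weakly_ergodic_markov f P" for k
      by (rule mem) (auto simp: field_simps)
    have "(\<lambda>k. R (inverse (real (Suc k)))) \<longlonglongrightarrow> (1 - 0) *\<^sub>R T + 0 *\<^sub>R Q"
      unfolding R_def by (intro tendsto_intros LIMSEQ_inverse_real_of_nat)
    then show "(\<lambda>k. R (inverse (real (Suc k)))) \<longlonglongrightarrow> T" by simp
  qed
qed

end

theorem theorem4p13:
  fixes f :: "'a::{banach, ordered_real_vector} \<Rightarrow> real" and P :: "'a \<Rightarrow> 'a"
  assumes "abstract_state_space f"
    and "markov_projection f P"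
    and "P \<noteq> id"
  shows "top_of_set (commuting_markov f P) closure_of weakly_ergodic_markov f P
           = commuting_markov f P
       \<and> openin (top_of_set (commuting_markov f P)) (weakly_ergodic_markov f P)"
proof -
  interpret abstract_state_space f by (rule assms(1))
  have "weakly_ergodic_markov f P \<subseteq> commuting_markov f P"
    by (auto simp: weakly_ergodic_markov_def)
  then have "top_of_set (commuting_markov f P) closure_of weakly_ergodic_markov f P
      = commuting_markov f P \<inter> closure (weakly_ergodic_markov f P)"
    by (simp add: closure_of_subtopology Int_absorb1)
  then show ?thesis
    using commuting_markov_subset_closure[OF assms(2,3)]
      openin_weakly_ergodic_markov[OF assms(2,3)] by blast
qed

end
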